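(* Let $P$ be a dcpo whose Scott space $\Sigma P$ is non-sober. Then at least one of the following holds: (1) $P$ is not meet-continuous; (2) $P$ is not Artinian.
   Context: A dcpo is a poset in which every directed (nonempty) subset has a supremum. For a poset $P$, $\sigma(P)$ is the Scott topology: $U$ is open iff it is an upper set and every directed $D$ with existing supremum $\bigvee D\in U$ meets $U$; $\Sigma P=(P,\sigma(P))$. A poset $P$ is meet-continuous if for every directed $D\subseteq P$ whose supremum exists and every $x\le\bigvee D$, $x$ lies in the $\sigma(P)$-closure of ${\downarrow}D\cap{\downarrow}x$. A poset is Artinian if every nonempty subset has a minimal element. A $T_0$ space is sober if every (nonempty) irreducible closed subset is the closure of a unique point. *)

theory Defs
  imports "HOL-Analysis.Analysis"
begin

text \<open>
  A poset is a carrier set \<open>P\<close> (possibly empty) together with a relation \<open>r\<close> such that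
  \<^term>\<open>partial_order_on P r\<close>, where \<open>(x, y) \<in> r\<close> is read \<open>x \<le> y\<close>.
\<close>

definition directed_in :: "'a set \<Rightarrow> 'a rel \<Rightarrow> 'a set \<Rightarrow> bool" where
  "directed_in P r D \<longleftrightarrow>
     D \<subseteq> P \<and> D \<noteq> {} \<and> (\<forall>x\<in>D. \<forall>y\<in>D. \<exists>z\<in>D. (x, z) \<in> r \<and> (y, z) \<in> r)"

definition is_supremum :: "'a set \<Rightarrow> 'a rel \<Rightarrow> 'a set \<Rightarrow> 'a \<Rightarrow> bool" where
  "is_supremum P r D s \<longleftrightarrow>
     s \<in> P \<and> (\<forall>d\<in>D. (d, s) \<in> r) \<and> (\<forall>u\<in>P. (\<forall>d\<in>D. (d, u) \<in> r) \<longrightarrow> (s, u) \<in> r)"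

definition dcpo :: "'a set \<Rightarrow> 'a rel \<Rightarrow> bool" where
  "dcpo P r \<longleftrightarrow>
     partial_order_on P r \<and> (\<forall>D. directed_in P r D \<longrightarrow> (\<exists>s. is_supremum P r D s))"

definition down_closure :: "'a set \<Rightarrow> 'a rel \<Rightarrow> 'a set \<Rightarrow> 'a set" where
  "down_closure P r A = {y \<in> P. \<exists>a\<in>A. (y, a) \<in> r}"

definition scott_open :: "'a set \<Rightarrow> 'a rel \<Rightarrow> 'a set \<Rightarrow> bool" where
  "scott_open P r U \<longleftrightarrow>
     U \<subseteq> P \<and>
     (\<forall>x\<in>U. \<forall>y\<in>P. (x, y) \<in> r \<longrightarrow> y \<in> U) \<and>
     (\<forall>D s. directed_in P r D \<longrightarrow> is_supremum P r D s \<longrightarrow> s \<in> U \<longrightarrow> D \<inter> U \<noteq> {})"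

definition scott_space :: "'a set \<Rightarrow> 'a rel \<Rightarrow> 'a topology" where
  "scott_space P r = topology (scott_open P r)"

lemma istopology_scott_open: "istopology (scott_open P r)"
proof -
  have "scott_open P r (U \<inter> V)" if U: "scott_open P r U" and V: "scott_open P r V" for U V
    unfolding scott_open_def
  proof (intro conjI allI impI ballI)
    show "U \<inter> V \<subseteq> P"
      using U by (auto simp: scott_open_def)
    show "y \<in> U \<inter> V" if "x \<in> U \<inter> V" "y \<in> P" "(x, y) \<in> r" for x y
      using that U V by (auto simp: scott_open_def)
    show "D \<inter> (U \<inter> V) \<noteq> {}"
      if D: "directed_in P r D" and s: "is_supremum P r D s" "s \<in> U \<inter> V" for D s
    proof -
      obtain u v where "u \<in> D \<inter> U" "v \<in> D \<inter> V"
        using U V D s unfolding scott_open_def by (metis IntD1 IntD2 ex_in_conv)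
      moreover from this obtain z where "z \<in> D" "(u, z) \<in> r" "(v, z) \<in> r"
        using D unfolding directed_in_def by blast
      moreover have "z \<in> P"
        using \<open>z \<in> D\<close> D unfolding directed_in_def by blast
      ultimately have "z \<in> U" "z \<in> V"
        using U V by (auto simp: scott_open_def)
      with \<open>z \<in> D\<close> show ?thesis
        by blast
    qed
  qed
  moreover have "scott_open P r (\<Union>\<U>)" if "\<forall>U\<in>\<U>. scott_open P r U" for \<U>
    unfolding scott_open_def
  proof (intro conjI allI impI ballI)
    show "\<Union>\<U> \<subseteq> P"
      using that by (auto simp: scott_open_def)
    show "y \<in> \<Union>\<U>" if "x \<in> \<Union>\<U>" "y \<in> P" "(x, y) \<in> r" for x y
      using that \<open>\<forall>U\<in>\<U>. scott_open P r U\<close> unfolding scott_open_def by (meson UnionE UnionI)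
    show "D \<inter> \<Union>\<U> \<noteq> {}"
      if D: "directed_in P r D" "is_supremum P r D s" "s \<in> \<Union>\<U>" for D s
    proof -
      obtain U where "U \<in> \<U>" "s \<in> U"
        using D by blast
      then have "D \<inter> U \<noteq> {}"
        using D \<open>\<forall>U\<in>\<U>. scott_open P r U\<close> unfolding scott_open_def by metis
      with \<open>U \<in> \<U>\<close> show ?thesis
        by blast
    qed
  qed
  ultimately show ?thesis
    unfolding istopology_def by blast
qed

lemma openin_scott_space: "openin (scott_space P r) U \<longleftrightarrow> scott_open P r U"
  by (simp add: scott_space_def istopology_scott_open)

lemma topspace_scott_space [simp]: "topspace (scott_space P r) = P"
proof -
  have "scott_open P r P"
    by (simp add: scott_open_def directed_in_def Int_absorb2)
  then show ?thesis
    unfolding topspace_def openin_scott_space by (auto simp: scott_open_def)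
qed

definition meet_continuous :: "'a set \<Rightarrow> 'a rel \<Rightarrow> bool" where
  "meet_continuous P r \<longleftrightarrow>
     (\<forall>D s x. directed_in P r D \<longrightarrow> is_supremum P r D s \<longrightarrow> x \<in> P \<longrightarrow> (x, s) \<in> r \<longrightarrow>
        x \<in> scott_space P r closure_of (down_closure P r D \<inter> down_closure P r {x}))"

definition artinian :: "'a set \<Rightarrow> 'a rel \<Rightarrow> bool" where
  "artinian P r \<longleftrightarrow>
     (\<forall>A. A \<subseteq> P \<longrightarrow> A \<noteq> {} \<longrightarrow> (\<exists>m\<in>A. \<forall>a\<in>A. (a, m) \<in> r \<longrightarrow> a = m))"

definition irreducible_closedin :: "'a topology \<Rightarrow> 'a set \<Rightarrow> bool" where
  "irreducible_closedin X C \<longleftrightarrow>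
     closedin X C \<and> C \<noteq> {} \<and>
     (\<forall>A B. closedin X A \<longrightarrow> closedin X B \<longrightarrow> C \<subseteq> A \<union> B \<longrightarrow> C \<subseteq> A \<or> C \<subseteq> B)"

definition sober_space :: "'a topology \<Rightarrow> bool" where
  "sober_space X \<longleftrightarrow>
     t0_space X \<and>
     (\<forall>C. irreducible_closedin X C \<longrightarrow> (\<exists>!x. x \<in> topspace X \<and> C = X closure_of {x}))"

end

theory Submission
  imports Defs
begin

text \<open>
  If \<open>m\<close> is minimal in a Scott open set \<open>U\<close>, then meet-continuity forces the up-set of \<open>m\<close> to be
  Scott open: when \<open>m \<le> \<Squnion>D\<close>, the neighbourhood \<open>U\<close> of \<open>m\<close> meets \<open>\<down>D \<inter> \<down>m\<close>, and by minimality
  only in \<open>m\<close>. In an Artinian poset every point of an open set lies above a minimal one, so these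
  compact elements generate the topology. The compact elements of an irreducible closed set \<open>C\<close>
  are then directed, and their supremum is the generic point of \<open>C\<close>.
\<close>

text \<open>In a poset this says that \<open>k\<close> is way below itself; the topological form
  lets principal up-sets be used directly as open sets.\<close>

definition compact_in :: "'a set \<Rightarrow> 'a rel \<Rightarrow> 'a \<Rightarrow> bool" where
  "compact_in P r k \<longleftrightarrow> k \<in> P \<and> scott_open P r {y \<in> P. (k, y) \<in> r}"

lemma scott_openD_up: "\<lbrakk>scott_open P r U; x \<in> U; y \<in> P; (x, y) \<in> r\<rbrakk> \<Longrightarrow> y \<in> U"
  by (auto simp: scott_open_def)

lemma scott_closed_down:
  assumes "closedin (scott_space P r) C" "y \<in> C" "x \<in> P" "(x, y) \<in> r"
  shows "x \<in> C"
proof -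
  have "scott_open P r (P - C)" "y \<in> P"
    using assms closedin_subset by (fastforce simp: closedin_def openin_scott_space)+
  then show ?thesis
    using assms scott_openD_up by fastforce
qed

lemma scott_closed_sup:
  assumes "closedin (scott_space P r) C" "directed_in P r D" "D \<subseteq> C" "is_supremum P r D s"
  shows "s \<in> C"
proof (rule ccontr)
  assume "s \<notin> C"
  moreover have "scott_open P r (P - C)"
    using assms(1) by (simp add: closedin_def openin_scott_space)
  moreover have "s \<in> P"
    using assms(4) by (simp add: is_supremum_def)
  ultimately have "D \<inter> (P - C) \<noteq> {}"
    using assms unfolding scott_open_def by blast
  with assms(3) show False
    by blast
qed

lemma closure_of_scott_singleton:
  assumes "partial_order_on P r" "x \<in> P"
  shows "scott_space P r closure_of {x} = {y \<in> P. (y, x) \<in> r}" (is "_ = ?L")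
proof
  have "refl_on P r" and "trans r"
    using assms(1) by (auto simp: partial_order_on_def preorder_on_def)
  have "scott_open P r (P - ?L)"
    unfolding scott_open_def
  proof (intro conjI allI impI ballI)
    show "z \<in> P - ?L" if "y \<in> P - ?L" "z \<in> P" "(y, z) \<in> r" for y z
      using that \<open>trans r\<close> by (auto dest: transD)
    \<comment> \<open>If all of \<open>D\<close> lay below \<open>x\<close>, then \<open>x\<close>
      would be an upper bound of \<open>D\<close>, forcing \<open>s\<close> below
      \<open>x\<close>.\<close>
    show "D \<inter> (P - ?L) \<noteq> {}"
      if "directed_in P r D" "is_supremum P r D s" "s \<in> P - ?L" for D s
      using that assms(2) unfolding directed_in_def is_supremum_def by blast
  qed auto
  then have "closedin (scott_space P r) ?L"
    by (auto simp: closedin_def openin_scott_space)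
  moreover have "x \<in> ?L"
    using \<open>refl_on P r\<close> assms(2) by (simp add: refl_on_def)
  ultimately show "scott_space P r closure_of {x} \<subseteq> ?L"
    by (simp add: closure_of_minimal)
  have "x \<in> scott_space P r closure_of {x}"
    using assms(2) by (simp add: in_closure_of)
  then show "?L \<subseteq> scott_space P r closure_of {x}"
    by (auto intro: scott_closed_down[OF closedin_closure_of])
qed

text \<open>Points with equal closures lie below each other by
  \<open>closure_of_scott_singleton\<close>, so antisymmetry identifies them.\<close>

lemma t0_space_scott_space:
  assumes "partial_order_on P r"
  shows "t0_space (scott_space P r)"
proof -
  have "refl_on P r" "antisym r"
    using assms by (auto simp: partial_order_on_def preorder_on_def)
  then show ?thesis
    unfolding t0_space_closure_of_sing topspace_scott_space
    by (metis (mono_tags, lifting) closure_of_scott_singleton[OF assms] mem_Collect_eq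
        refl_onD antisymD)
qed

lemma compact_in_minimal:
  assumes "partial_order_on P r" "meet_continuous P r" "scott_open P r U" "m \<in> U"
    and minimal: "\<And>a. \<lbrakk>a \<in> U; (a, m) \<in> r\<rbrakk> \<Longrightarrow> a = m"
  shows "compact_in P r m"
  unfolding compact_in_def
proof
  show "m \<in> P"
    using assms(3,4) by (auto simp: scott_open_def)
  have "trans r"
    using assms(1) by (simp add: partial_order_on_def preorder_on_def)
  show "scott_open P r {y \<in> P. (m, y) \<in> r}"
    unfolding scott_open_def
  proof (intro conjI allI impI ballI)
    show "z \<in> {y \<in> P. (m, y) \<in> r}" if "y \<in> {y \<in> P. (m, y) \<in> r}" "z \<in> P" "(y, z) \<in> r" for y z
      using that \<open>trans r\<close> by (auto dest: transD)
    show "D \<inter> {y \<in> P. (m, y) \<in> r} \<noteq> {}"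
      if D: "directed_in P r D" "is_supremum P r D s" "s \<in> {y \<in> P. (m, y) \<in> r}" for D s
    proof -
      have "m \<in> scott_space P r closure_of (down_closure P r D \<inter> down_closure P r {m})"
        using assms(2) D \<open>m \<in> P\<close> unfolding meet_continuous_def by blast
      then obtain a where "a \<in> U" "a \<in> down_closure P r D" "a \<in> down_closure P r {m}"
        using assms(3,4) by (auto simp: in_closure_of openin_scott_space)
      then have "m \<in> down_closure P r D"
        using minimal by (auto simp: down_closure_def)
      then show ?thesis
        using D by (auto simp: down_closure_def directed_in_def)
    qed
  qed auto
qed

lemma compact_in_below:
  assumes "partial_order_on P r" "meet_continuous P r" "artinian P r"
    and "scott_open P r U" "x \<in> U"
  obtains k where "compact_in P r k" "k \<in> U" "(k, x) \<in> r"
proof -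
  have refl: "refl_on P r" and "trans r"
    using assms(1) by (auto simp: partial_order_on_def preorder_on_def)
  have "U \<subseteq> P"
    using assms(4) by (simp add: scott_open_def)
  then have "(x, x) \<in> r"
    using refl assms(5) by (auto simp: refl_on_def)
  \<comment> \<open>The Artinian condition is applied to the part of \<open>U\<close> below
    \<open>x\<close>, so that the minimal element it yields is itself below
    \<open>x\<close>.\<close>
  then have "{a \<in> U. (a, x) \<in> r} \<subseteq> P" "{a \<in> U. (a, x) \<in> r} \<noteq> {}"
    using \<open>U \<subseteq> P\<close> assms(5) by auto
  then obtain m where m: "m \<in> U" "(m, x) \<in> r"
      and min: "\<And>a. \<lbrakk>a \<in> U; (a, x) \<in> r; (a, m) \<in> r\<rbrakk> \<Longrightarrow> a = m"
    using assms(3)[unfolded artinian_def, rule_format, of "{a \<in> U. (a, x) \<in> r}"] by blast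
  have "compact_in P r m"
    using assms(1,2,4) m(1)
  proof (rule compact_in_minimal)
    \<comment> \<open>Minimality extends to all of \<open>U\<close>: whatever lies below
      \<open>m\<close> also lies below \<open>x\<close>.\<close>
    show "a = m" if "a \<in> U" "(a, m) \<in> r" for a
      using that min m(2) \<open>trans r\<close> by (blast dest: transD)
  qed
  with m that show thesis
    by blast
qed

text \<open>Two open sets that each meet an irreducible closed set meet it in a common point. For
  the principal up-sets of two compact elements of \<open>C\<close>, such a point is an upper bound
  in \<open>C\<close>, and a compact one can be found beneath it.\<close>

lemma directed_compact_in_irreducible:
  assumes "partial_order_on P r" "meet_continuous P r" "artinian P r"
    and C: "irreducible_closedin (scott_space P r) C"
  shows "directed_in P r {k \<in> C. compact_in P r k}"
  unfolding directed_in_def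
proof (intro conjI ballI)
  have cl: "closedin (scott_space P r) C" and "C \<noteq> {}"
    using C by (auto simp: irreducible_closedin_def)
  then have "C \<subseteq> P"
    using closedin_subset by fastforce
  \<comment> \<open>Every open set meeting \<open>C\<close> contains a compact element of
    \<open>C\<close>, because the one found below \<open>c\<close> stays in the down-set
    \<open>C\<close>.\<close>
  have below: "\<exists>k \<in> {k \<in> C. compact_in P r k}. k \<in> U"
    if U: "scott_open P r U" and c: "c \<in> U" "c \<in> C" for U c
  proof -
    obtain k where k: "compact_in P r k" "k \<in> U" "(k, c) \<in> r"
      using compact_in_below[OF assms(1-3) U c(1)] by blast
    then have "k \<in> C"
      using scott_closed_down[OF cl c(2)] by (simp add: compact_in_def)
    with k show ?thesis
      by blast
  qed
  show "{k \<in> C. compact_in P r k} \<subseteq> P"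
    using \<open>C \<subseteq> P\<close> by blast
  have "scott_open P r P"
    using openin_topspace[of "scott_space P r"] by (simp add: openin_scott_space)
  then show "{k \<in> C. compact_in P r k} \<noteq> {}"
    using below \<open>C \<noteq> {}\<close> \<open>C \<subseteq> P\<close> by blast
  fix k l
  assume kl: "k \<in> {k \<in> C. compact_in P r k}" "l \<in> {k \<in> C. compact_in P r k}"
  define U where "U x = {y \<in> P. (x, y) \<in> r}" for x
  have op: "openin (scott_space P r) (U k)" "openin (scott_space P r) (U l)"
    using kl by (auto simp: U_def compact_in_def openin_scott_space)
  have "k \<in> U k" "l \<in> U l"
    using kl assms(1) by (auto simp: U_def compact_in_def partial_order_on_def preorder_on_def refl_on_def)
  \<comment> \<open>Irreducibility is stated for closed covers, so it is used on the complements of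
    the two up-sets.\<close>
  then have "\<not> C \<subseteq> P - U k" "\<not> C \<subseteq> P - U l"
    using kl by auto
  moreover have "closedin (scott_space P r) (P - U k)" "closedin (scott_space P r) (P - U l)"
    using op closedin_diff[OF closedin_topspace] by fastforce+
  ultimately have "\<not> C \<subseteq> (P - U k) \<union> (P - U l)"
    using C unfolding irreducible_closedin_def by blast
  then obtain c where "c \<in> C" "c \<in> U k \<inter> U l"
    using \<open>C \<subseteq> P\<close> by blast
  moreover have "scott_open P r (U k \<inter> U l)"
    using openin_Int[OF op] by (simp add: openin_scott_space)
  ultimately show "\<exists>z \<in> {k \<in> C. compact_in P r k}. (k, z) \<in> r \<and> (l, z) \<in> r"
    using below by (fastforce simp: U_def)
qed

theorem theorem6p5:
  fixes P :: "'a set" and r :: "'a rel"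
  assumes "dcpo P r"
    and "\<not> sober_space (scott_space P r)"
  shows "\<not> meet_continuous P r \<or> \<not> artinian P r"
proof (rule ccontr)
  assume "\<not> (\<not> meet_continuous P r \<or> \<not> artinian P r)"
  then have mc: "meet_continuous P r" and art: "artinian P r"
    by auto
  have po: "partial_order_on P r"
    using assms(1) by (simp add: dcpo_def)
  have t0: "t0_space (scott_space P r)"
    by (rule t0_space_scott_space[OF po])
  have "\<exists>!x. x \<in> topspace (scott_space P r) \<and> C = scott_space P r closure_of {x}"
    if C: "irreducible_closedin (scott_space P r) C" for C
  proof -
    define K where "K = {k \<in> C. compact_in P r k}"
    have cl: "closedin (scott_space P r) C"
      using C by (simp add: irreducible_closedin_def)
    then have "C \<subseteq> P"
      using closedin_subset by fastforce
    have K: "directed_in P r K"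
      unfolding K_def by (rule directed_compact_in_irreducible[OF po mc art C])
    then obtain s where s: "is_supremum P r K s"
      using assms(1) unfolding dcpo_def by blast
    then have "s \<in> P"
      by (simp add: is_supremum_def)
    \<comment> \<open>Scott closed sets contain the suprema of their directed subsets.\<close>
    have "s \<in> C"
      using scott_closed_sup[OF cl K _ s] by (auto simp: K_def)
    have "C \<subseteq> scott_space P r closure_of {s}"
    proof
      fix c assume "c \<in> C"
      \<comment> \<open>A neighbourhood of \<open>c\<close> contains a compact \<open>k\<close>
        below \<open>c\<close>; then \<open>k\<close> belongs to \<open>K\<close>, so
        \<open>s\<close> is above \<open>k\<close> and in the same neighbourhood.\<close>
      moreover have "s \<in> U" if U: "scott_open P r U" "c \<in> U" for U
      proof -
        obtain k where k: "compact_in P r k" "k \<in> U" "(k, c) \<in> r"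
          using compact_in_below[OF po mc art U] by blast
        then have "k \<in> K"
          using scott_closed_down[OF cl \<open>c \<in> C\<close>] by (simp add: compact_in_def K_def)
        then show "s \<in> U"
          using s scott_openD_up[OF U(1) k(2)] by (simp add: is_supremum_def)
      qed
      ultimately show "c \<in> scott_space P r closure_of {s}"
        using \<open>C \<subseteq> P\<close> by (auto simp: in_closure_of openin_scott_space)
    qed
    then have "C = scott_space P r closure_of {s}"
      using closure_of_minimal[OF _ cl] \<open>s \<in> C\<close> by blast
    \<comment> \<open>Uniqueness of the generic point is the T0 property.\<close>
    then show ?thesis
      using t0 \<open>s \<in> P\<close> unfolding t0_space_closure_of_sing by auto
  qed
  with t0 have "sober_space (scott_space P r)"
    unfolding sober_space_def by blast
  with assms(2) show False ..
qed

end
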